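(* Let $\varphi_e$ and $\varphi_{e_1}$ be two ruled surfaces in $\mathbb{R}^3$ that form a Bertrand surface offset, with offset angle $\theta$ and offset distance $\theta^*$, and let $\varphi_e$ be developable. Then the Bertrand offset $\varphi_{e_1}$ is developable if and only if $$\theta^*=\frac{\delta\sin\theta}{\sin\theta-\gamma\cos\theta}$$ holds.
   Context: Dual numbers are $\bar a=a+\varepsilon a^*$ with $a,a^*\in\mathbb{R}$, $\varepsilon\neq 0$, $\varepsilon^2=0$. For a differentiable real function $f$, $f(x+\varepsilon x^* )=f(x)+\varepsilon x^*f'(x)$; e.g. $\cos(x+\varepsilon x^* )=\cos x-\varepsilon x^*\sin x$, $\sin(x+\varepsilon x^* )=\sin x+\varepsilon x^*\cos x$. Dual vectors are $\tilde a=\vec a+\varepsilon\vec a^*$ with $\vec a,\vec a^*\in\mathbb{R}^3$; scalar and vector products are extended $\varepsilon$-bilinearly. A ruled surface $\varphi_e=\vec c(s)+v\,\vec e(s)$ is parametrized so that $\langle \vec e,\vec e\rangle=1$, $\langle \vec e',\vec e'\rangle=1$, $\langle \vec c',\vec e'\rangle=0$, where prime is $d/ds$; so $s$ is the arc length of the real indicatrix $\vec e(s)$ and $\vec c$ is the striction line. It is represented by the dual unit vector $\tilde e=\vec e+\varepsilon\,\vec c\times\vec e$. Put $\vec t=\vec e'$, $\vec g=\vec e\times\vec t$; the conical curvature $\gamma$ is defined by $\vec e'=\vec t$, $\vec t'=\gamma\vec g-\vec e$, $\vec g'=-\gamma\vec t$. Put $\Delta=\det(\vec c',\vec e,\vec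 t)$, $\delta=\langle\vec c',\vec e\rangle$. The surface $\varphi_e$ is developable if and only if $\Delta=0$. The dual Darboux frame is $\{\tilde e,\tilde t,\tilde g\}$ with $\tilde t=\vec t+\varepsilon\,\vec c\times\vec t$, $\tilde g=\tilde e\times\tilde t=\vec g+\varepsilon\,\vec c\times\vec g$. The corresponding objects of a second ruled surface $\varphi_{e_1}$ (with its own parameter $s_1$, derivatives taken with respect to $s_1$) carry the subscript $1$. $\varphi_e$ and $\varphi_{e_1}$ form a Bertrand surface offset if $\tilde t=\tilde t_1$ at corresponding parameters $s$, $s_1$. The frames are then related by $\tilde e_1=\cos\bar\theta\,\tilde e-\sin\bar\theta\,\tilde g$, $\tilde t_1=\tilde t$, $\tilde g_1=\sin\bar\theta\,\tilde e+\cos\bar\theta\,\tilde g$, where $\bar\theta=\theta+\varepsilon\theta^*$ ($0\le\theta\le\pi$, $\theta^*\in\mathbb{R}$) is the dual angle between the generators $\tilde e$ and $\tilde e_1$; $\theta$ is called the offset angle and $\theta^*$ the offset distance.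
   Formalization: The formal statement additionally assumes sin θ − γ cos θ ≠ 0 at every s, so that the quotient is defined; without this the claim fails, e.g. for a circular cone with constant γ = tan θ (δ = 0), whose offset is developable for every θ*. *)

theory Defs
  imports "HOL-Analysis.Analysis"
begin

section \<open>Dual numbers and dual vectors\<close>

text \<open>The pair \<open>(x, x')\<close> stands for \<open>x + \<epsilon> x'\<close> with \<open>\<epsilon>\<^sup>2 = 0\<close>; addition and subtraction are those
  of the product type.\<close>

type_synonym dual_num = "real \<times> real"
type_synonym dual_vec = "(real^3) \<times> (real^3)"

definition dual_lift :: "(real \<Rightarrow> real) \<Rightarrow> dual_num \<Rightarrow> dual_num" where
  "dual_lift f x = (f (fst x), snd x * deriv f (fst x))"

abbreviation dual_cos :: "dual_num \<Rightarrow> dual_num" where "dual_cos \<equiv> dual_lift cos"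
abbreviation dual_sin :: "dual_num \<Rightarrow> dual_num" where "dual_sin \<equiv> dual_lift sin"

definition dual_scale :: "dual_num \<Rightarrow> dual_vec \<Rightarrow> dual_vec" (infixr "*\<^sub>D" 75) where
  "x *\<^sub>D a = (fst x *\<^sub>R fst a, fst x *\<^sub>R snd a + snd x *\<^sub>R fst a)"

definition dual_cross :: "dual_vec \<Rightarrow> dual_vec \<Rightarrow> dual_vec" where
  "dual_cross a b = (cross3 (fst a) (fst b), cross3 (fst a) (snd b) + cross3 (snd a) (fst b))"

lemma dual_cos_eq: "dual_cos (x, y) = (cos x, - (y * sin x))"
proof -
  have "deriv cos x = - sin x"
    by (rule DERIV_imp_deriv) (auto intro!: derivative_eq_intros)
  then show ?thesis by (simp add: dual_lift_def)
qed

lemma dual_sin_eq: "dual_sin (x, y) = (sin x, y * cos x)"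
proof -
  have "deriv sin x = cos x"
    by (rule DERIV_imp_deriv) (auto intro!: derivative_eq_intros)
  then show ?thesis by (simp add: dual_lift_def)
qed

section \<open>Ruled surfaces\<close>

text \<open>A ruled surface is given by its striction line \<open>c\<close> and its real indicatrix \<open>e\<close>.\<close>

definition ruled_param :: "(real \<Rightarrow> real^3) \<Rightarrow> (real \<Rightarrow> real^3) \<Rightarrow> real \<Rightarrow> real \<Rightarrow> real^3" where
  "ruled_param c e s v = c s + v *\<^sub>R e s"

definition tvec :: "(real \<Rightarrow> real^3) \<Rightarrow> real \<Rightarrow> real^3" where
  "tvec e s = vector_derivative e (at s)"

definition gvec :: "(real \<Rightarrow> real^3) \<Rightarrow> real \<Rightarrow> real^3" where
  "gvec e s = cross3 (e s) (tvec e s)"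

text \<open>Differentiability of \<open>tvec e\<close> is what the conical curvature needs; no further smoothness is
  required.\<close>

definition ruled_surface :: "real set \<Rightarrow> (real \<Rightarrow> real^3) \<Rightarrow> (real \<Rightarrow> real^3) \<Rightarrow> bool" where
  "ruled_surface I c e \<longleftrightarrow>
     open I \<and> is_interval I \<and> I \<noteq> {} \<and>
     (\<forall>s\<in>I. c differentiable at s \<and> e differentiable at s \<and> tvec e differentiable at s \<and>
        e s \<bullet> e s = 1 \<and> tvec e s \<bullet> tvec e s = 1 \<and> vector_derivative c (at s) \<bullet> tvec e s = 0)"

text \<open>The \<open>g\<close>-component of \<open>t'\<close>; see \<open>darboux_formulas\<close> below for the defining equations.\<close>

definition conical_curvature :: "(real \<Rightarrow> real^3) \<Rightarrow> real \<Rightarrow> real" where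
  "conical_curvature e s = vector_derivative (tvec e) (at s) \<bullet> gvec e s"

definition Delta :: "(real \<Rightarrow> real^3) \<Rightarrow> (real \<Rightarrow> real^3) \<Rightarrow> real \<Rightarrow> real" where
  "Delta c e s = det (vector [vector_derivative c (at s), e s, tvec e s] :: real^3^3)"

definition delta :: "(real \<Rightarrow> real^3) \<Rightarrow> (real \<Rightarrow> real^3) \<Rightarrow> real \<Rightarrow> real" where
  "delta c e s = vector_derivative c (at s) \<bullet> e s"

section \<open>Developability\<close>

definition partial_s :: "(real \<Rightarrow> real^3) \<Rightarrow> (real \<Rightarrow> real^3) \<Rightarrow> real \<Rightarrow> real \<Rightarrow> real^3" where
  "partial_s c e s v = vector_derivative (\<lambda>x. ruled_param c e x v) (at s)"

definition partial_v :: "(real \<Rightarrow> real^3) \<Rightarrow> (real \<Rightarrow> real^3) \<Rightarrow> real \<Rightarrow> real \<Rightarrow> real^3" where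
  "partial_v c e s v = vector_derivative (\<lambda>y. ruled_param c e s y) (at v)"

definition nonsingular_point :: "(real \<Rightarrow> real^3) \<Rightarrow> (real \<Rightarrow> real^3) \<Rightarrow> real \<Rightarrow> real \<Rightarrow> bool" where
  "nonsingular_point c e s v \<longleftrightarrow> cross3 (partial_s c e s v) (partial_v c e s v) \<noteq> 0"

definition tangent_plane :: "(real \<Rightarrow> real^3) \<Rightarrow> (real \<Rightarrow> real^3) \<Rightarrow> real \<Rightarrow> real \<Rightarrow> (real^3) set" where
  "tangent_plane c e s v =
     {ruled_param c e s v + x |x. x \<in> span {partial_s c e s v, partial_v c e s v}}"

text \<open>All nonsingular points of one ruling have the same tangent plane. The characterization by
  \<open>\<Delta> = 0\<close> is \<open>developable_iff_Delta\<close> below.\<close>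

definition developable :: "real set \<Rightarrow> (real \<Rightarrow> real^3) \<Rightarrow> (real \<Rightarrow> real^3) \<Rightarrow> bool" where
  "developable I c e \<longleftrightarrow>
     (\<forall>s\<in>I. \<forall>v w. nonsingular_point c e s v \<longrightarrow> nonsingular_point c e s w \<longrightarrow>
        tangent_plane c e s v = tangent_plane c e s w)"

section \<open>Dual Darboux frame and Bertrand offsets\<close>

definition dual_e :: "(real \<Rightarrow> real^3) \<Rightarrow> (real \<Rightarrow> real^3) \<Rightarrow> real \<Rightarrow> dual_vec" where
  "dual_e c e s = (e s, cross3 (c s) (e s))"

definition dual_t :: "(real \<Rightarrow> real^3) \<Rightarrow> (real \<Rightarrow> real^3) \<Rightarrow> real \<Rightarrow> dual_vec" where
  "dual_t c e s = (tvec e s, cross3 (c s) (tvec e s))"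

definition dual_g :: "(real \<Rightarrow> real^3) \<Rightarrow> (real \<Rightarrow> real^3) \<Rightarrow> real \<Rightarrow> dual_vec" where
  "dual_g c e s = dual_cross (dual_e c e s) (dual_t c e s)"

text \<open>The map \<open>\<sigma>\<close> sends a parameter \<open>s\<close> of the first surface to the corresponding parameter \<open>s\<^sub>1\<close> of
  the second. Derivatives of \<open>c1\<close> and \<open>e1\<close> are taken with respect to \<open>s\<^sub>1\<close>.\<close>

definition bertrand_offset ::
  "real set \<Rightarrow> (real \<Rightarrow> real^3) \<Rightarrow> (real \<Rightarrow> real^3) \<Rightarrow>
   real set \<Rightarrow> (real \<Rightarrow> real^3) \<Rightarrow> (real \<Rightarrow> real^3) \<Rightarrow> (real \<Rightarrow> real) \<Rightarrow> bool" where
  "bertrand_offset I c e I1 c1 e1 \<sigma> \<longleftrightarrow>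
     bij_betw \<sigma> I I1 \<and> (\<forall>s\<in>I. \<sigma> differentiable at s) \<and>
     (\<forall>s\<in>I. dual_t c e s = dual_t c1 e1 (\<sigma> s))"

text \<open>\<open>\<theta> s\<close> is the offset angle and \<open>\<theta>' s\<close> the offset distance at \<open>s\<close>; their constancy is not assumed.
  The relation for the third frame vector follows, see \<open>offset_dual_g\<close> below.\<close>

definition offset_dual_angle ::
  "real set \<Rightarrow> (real \<Rightarrow> real^3) \<Rightarrow> (real \<Rightarrow> real^3) \<Rightarrow>
   (real \<Rightarrow> real^3) \<Rightarrow> (real \<Rightarrow> real^3) \<Rightarrow> (real \<Rightarrow> real) \<Rightarrow> (real \<Rightarrow> real) \<Rightarrow> (real \<Rightarrow> real) \<Rightarrow> bool" where
  "offset_dual_angle I c e c1 e1 \<sigma> \<theta> \<theta>' \<longleftrightarrow>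
     (\<forall>s\<in>I. 0 \<le> \<theta> s \<and> \<theta> s \<le> pi \<and>
        dual_e c1 e1 (\<sigma> s) =
          dual_cos (\<theta> s, \<theta>' s) *\<^sub>D dual_e c e s - dual_sin (\<theta> s, \<theta>' s) *\<^sub>D dual_g c e s)"

section \<open>Consistency of the definitions\<close>

lemma dual_g_eq: "dual_g c e s = (gvec e s, cross3 (c s) (gvec e s))"
  unfolding dual_g_def dual_cross_def dual_e_def dual_t_def gvec_def
  by (simp add: cross3_simps)

lemma frame_orthonormal:
  assumes "ruled_surface I c e" and s: "s \<in> I"
  shows "e s \<bullet> e s = 1" "tvec e s \<bullet> tvec e s = 1" "e s \<bullet> tvec e s = 0"
    "gvec e s \<bullet> e s = 0" "gvec e s \<bullet> tvec e s = 0" "gvec e s \<bullet> gvec e s = 1"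
    "cross3 (gvec e s) (tvec e s) = - e s"
proof -
  have I: "open I" and ee: "\<And>x. x \<in> I \<Longrightarrow> e x \<bullet> e x = 1" and tt: "tvec e s \<bullet> tvec e s = 1"
    and d: "(e has_vector_derivative tvec e s) (at s)"
    using assms by (auto simp: ruled_surface_def tvec_def vector_derivative_works)
  show e1: "e s \<bullet> e s = 1" "tvec e s \<bullet> tvec e s = 1" using ee s tt by auto
  have "((\<lambda>x. e x \<bullet> e x) has_vector_derivative (e s \<bullet> tvec e s + tvec e s \<bullet> e s)) (at s)"
    by (rule bounded_bilinear.has_vector_derivative[OF bounded_bilinear_inner d d])
  moreover have "((\<lambda>x. e x \<bullet> e x) has_vector_derivative 0) (at s)"
    by (rule has_vector_derivative_transform_within_open[OF _ I s, of "\<lambda>_. 1"])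
      (auto simp: ee)
  ultimately have "e s \<bullet> tvec e s + tvec e s \<bullet> e s = 0"
    by (rule vector_derivative_unique_at)
  then show et: "e s \<bullet> tvec e s = 0" by (simp add: inner_commute)
  show "gvec e s \<bullet> e s = 0" "gvec e s \<bullet> tvec e s = 0"
    by (simp_all add: gvec_def dot_cross_self)
  have "norm (gvec e s)^2 = 1"
    using norm_cross_dot[of "e s" "tvec e s"] e1 et by (simp add: gvec_def power2_norm_eq_inner power_mult_distrib)
  then show "gvec e s \<bullet> gvec e s = 1" by (simp add: power2_norm_eq_inner)
  have "cross3 (gvec e s) (tvec e s) = (e s \<bullet> tvec e s) *\<^sub>R tvec e s - (tvec e s \<bullet> tvec e s) *\<^sub>R e s"
    using Lagrange[of "tvec e s" "e s" "tvec e s"] cross_skew[of "gvec e s" "tvec e s"]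
    by (simp add: gvec_def inner_commute)
  then show "cross3 (gvec e s) (tvec e s) = - e s" using e1 et by simp
qed

lemma frame_expand:
  assumes "ruled_surface I c e" and s: "s \<in> I"
  shows "x = (x \<bullet> e s) *\<^sub>R e s + (x \<bullet> tvec e s) *\<^sub>R tvec e s + (x \<bullet> gvec e s) *\<^sub>R gvec e s"
proof -
  note o = frame_orthonormal[OF assms]
  define y where "y = x - ((x \<bullet> e s) *\<^sub>R e s + (x \<bullet> tvec e s) *\<^sub>R tvec e s + (x \<bullet> gvec e s) *\<^sub>R gvec e s)"
  have y: "y \<bullet> e s = 0" "y \<bullet> tvec e s = 0" "y \<bullet> gvec e s = 0"
    using o by (simp_all add: y_def inner_simps inner_commute)
  have "cross3 y (gvec e s) = 0"
    using Lagrange[of y "e s" "tvec e s"] y by (simp add: gvec_def)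
  then have "norm y ^ 2 * norm (gvec e s) ^ 2 = 0"
    using norm_cross_dot[of y "gvec e s"] y by (simp add: power_mult_distrib)
  moreover have "norm (gvec e s) ^ 2 = 1" using o by (simp add: power2_norm_eq_inner)
  ultimately have "y = 0" by simp
  then show ?thesis by (simp add: y_def)
qed

lemma darboux_formulas:
  assumes "ruled_surface I c e" and s: "s \<in> I"
  shows "(e has_vector_derivative tvec e s) (at s)"
    "(tvec e has_vector_derivative conical_curvature e s *\<^sub>R gvec e s - e s) (at s)"
    "(gvec e has_vector_derivative - (conical_curvature e s *\<^sub>R tvec e s)) (at s)"
proof -
  note o = frame_orthonormal[OF assms]
  have I: "open I" and d: "(e has_vector_derivative tvec e s) (at s)"
    and dt: "(tvec e has_vector_derivative vector_derivative (tvec e) (at s)) (at s)"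
      (is "(_ has_vector_derivative ?t') _")
    using assms by (auto simp: ruled_surface_def tvec_def vector_derivative_works)
  show "(e has_vector_derivative tvec e s) (at s)" by (rule d)
  have "((\<lambda>x. tvec e x \<bullet> tvec e x) has_vector_derivative (tvec e s \<bullet> ?t' + ?t' \<bullet> tvec e s)) (at s)"
    by (rule bounded_bilinear.has_vector_derivative[OF bounded_bilinear_inner dt dt])
  moreover have "((\<lambda>x. tvec e x \<bullet> tvec e x) has_vector_derivative 0) (at s)"
    by (rule has_vector_derivative_transform_within_open[OF _ I s, of "\<lambda>_. 1"])
      (auto simp: frame_orthonormal[OF assms(1)])
  ultimately have "tvec e s \<bullet> ?t' + ?t' \<bullet> tvec e s = 0"
    by (rule vector_derivative_unique_at)
  then have 1: "?t' \<bullet> tvec e s = 0" by (simp add: inner_commute)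
  have "((\<lambda>x. e x \<bullet> tvec e x) has_vector_derivative (e s \<bullet> ?t' + tvec e s \<bullet> tvec e s)) (at s)"
    by (rule bounded_bilinear.has_vector_derivative[OF bounded_bilinear_inner d dt])
  moreover have "((\<lambda>x. e x \<bullet> tvec e x) has_vector_derivative 0) (at s)"
    by (rule has_vector_derivative_transform_within_open[OF _ I s, of "\<lambda>_. 0"])
      (auto simp: frame_orthonormal[OF assms(1)])
  ultimately have "e s \<bullet> ?t' + tvec e s \<bullet> tvec e s = 0"
    by (rule vector_derivative_unique_at)
  then have 2: "?t' \<bullet> e s = - 1" using o by (simp add: inner_commute)
  have t': "?t' = conical_curvature e s *\<^sub>R gvec e s - e s"
    using frame_expand[OF assms, of ?t'] 1 2 by (simp add: conical_curvature_def)
  then show "(tvec e has_vector_derivative conical_curvature e s *\<^sub>R gvec e s - e s) (at s)"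
    using dt by simp
  have "((\<lambda>x. cross3 (e x) (tvec e x)) has_vector_derivative
      (cross3 (e s) ?t' + cross3 (tvec e s) (tvec e s))) (at s)"
    by (rule bounded_bilinear.has_vector_derivative[OF _ d dt])
      (simp add: bilinear_conv_bounded_bilinear[symmetric] bilinear_cross)
  moreover have "cross3 (e s) (gvec e s) = - tvec e s"
    using Lagrange[of "e s" "e s" "tvec e s"] o by (simp add: gvec_def)
  ultimately show "(gvec e has_vector_derivative - (conical_curvature e s *\<^sub>R tvec e s)) (at s)"
    by (simp add: gvec_def[abs_def] t' Cross3.right_diff_distrib cross_mult_right)
qed

lemma Delta_eq: "Delta c e s = vector_derivative c (at s) \<bullet> gvec e s"
  by (simp add: Delta_def gvec_def dot_cross_det)

lemma developable_iff_Delta: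
  assumes "ruled_surface I c e"
  shows "developable I c e \<longleftrightarrow> (\<forall>s\<in>I. Delta c e s = 0)"
proof -
  have "(\<forall>v w. nonsingular_point c e s v \<longrightarrow> nonsingular_point c e s w \<longrightarrow>
        tangent_plane c e s v = tangent_plane c e s w) \<longleftrightarrow> Delta c e s = 0" (is "?L \<longleftrightarrow> ?R")
    if s: "s \<in> I" for s
  proof -
    note o = frame_orthonormal[OF assms s]
    let ?e = "e s" and ?t = "tvec e s" and ?g = "gvec e s"
    let ?D = "Delta c e s" and ?d = "delta c e s"
    have dc: "(c has_vector_derivative vector_derivative c (at s)) (at s)"
      and ct: "vector_derivative c (at s) \<bullet> ?t = 0"
      using assms s by (auto simp: ruled_surface_def vector_derivative_works)
    have c': "vector_derivative c (at s) = ?d *\<^sub>R ?e + ?D *\<^sub>R ?g"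
      using frame_expand[OF assms s, of "vector_derivative c (at s)"] ct
      by (simp add: delta_def Delta_eq)
    have ps: "partial_s c e s v = ?d *\<^sub>R ?e + ?D *\<^sub>R ?g + v *\<^sub>R ?t" for v
    proof -
      have "((\<lambda>x. c x + v *\<^sub>R e x) has_vector_derivative vector_derivative c (at s) + v *\<^sub>R ?t) (at s)"
        using dc darboux_formulas(1)[OF assms s]
        by (auto intro!: derivative_eq_intros)
      then show ?thesis
        unfolding partial_s_def ruled_param_def by (simp add: vector_derivative_at c')
    qed
    have pv: "partial_v c e s v = ?e" for v
    proof -
      have "((\<lambda>y. c s + y *\<^sub>R ?e) has_vector_derivative ?e) (at v)"
        by (auto intro!: derivative_eq_intros)
      then show ?thesis unfolding partial_v_def ruled_param_def by (rule vector_derivative_at)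
    qed
    have ge: "cross3 ?g ?e = ?t"
      using Lagrange[of ?e ?e ?t] o cross_skew[of ?g ?e] by (simp add: gvec_def)
    have te: "cross3 ?t ?e = - ?g" using cross_skew[of ?t ?e] by (simp add: gvec_def)
    have N: "cross3 (partial_s c e s v) (partial_v c e s v) = ?D *\<^sub>R ?t - v *\<^sub>R ?g" for v
      by (simp add: ps pv cross_add_left cross_mult_left ge te)
    show ?thesis
    proof
      assume D: ?R
      have tp: "tangent_plane c e s v = {c s + x |x. x \<in> span {?t, ?e}}" if "nonsingular_point c e s v" for v
      proof -
        have v: "v \<noteq> 0" using that D by (auto simp: nonsingular_point_def N)
        have "span {?d *\<^sub>R ?e + v *\<^sub>R ?t, ?e} = span {?t, ?e}"
        proof (rule span_eq[THEN iffD2], intro conjI subsetI)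
          fix x assume "x \<in> {?d *\<^sub>R ?e + v *\<^sub>R ?t, ?e}"
          moreover have "?d *\<^sub>R ?e + v *\<^sub>R ?t \<in> span {?t, ?e}"
            by (intro span_add span_scale span_base) auto
          ultimately show "x \<in> span {?t, ?e}" by (auto intro: span_base)
        next
          fix x assume x: "x \<in> {?t, ?e}"
          have "?t = (1/v) *\<^sub>R ((?d *\<^sub>R ?e + v *\<^sub>R ?t) - ?d *\<^sub>R ?e)" using v by simp
          also have "\<dots> \<in> span {?d *\<^sub>R ?e + v *\<^sub>R ?t, ?e}"
            by (intro span_scale span_diff span_base) auto
          finally show "x \<in> span {?d *\<^sub>R ?e + v *\<^sub>R ?t, ?e}"
            using x by (auto intro: span_base)
        qed
        then have *: "tangent_plane c e s v = {c s + v *\<^sub>R ?e + x |x. x \<in> span {?t, ?e}}"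
          by (simp add: tangent_plane_def ps pv D ruled_param_def)
        have e: "r *\<^sub>R ?e \<in> span {?t, ?e}" for r
          by (intro span_scale span_base) auto
        show ?thesis unfolding *
        proof (intro set_eqI iffI)
          fix y assume "y \<in> {c s + v *\<^sub>R ?e + x |x. x \<in> span {?t, ?e}}"
          then obtain x where "x \<in> span {?t, ?e}" "y = c s + (v *\<^sub>R ?e + x)" by (auto simp: add.assoc)
          then show "y \<in> {c s + x |x. x \<in> span {?t, ?e}}" using span_add[OF e] by blast
        next
          fix y assume "y \<in> {c s + x |x. x \<in> span {?t, ?e}}"
          then obtain x where "x \<in> span {?t, ?e}" "y = c s + v *\<^sub>R ?e + (x - v *\<^sub>R ?e)" by auto
          then show "y \<in> {c s + v *\<^sub>R ?e + x |x. x \<in> span {?t, ?e}}" using span_diff[OF _ e] by blast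
        qed
      qed
      then show ?L by simp
    next
      assume L: ?L
      show ?R
      proof (rule ccontr)
        assume D: "?D \<noteq> 0"
        have ns: "nonsingular_point c e s v" for v
        proof -
          have "(?D *\<^sub>R ?t - v *\<^sub>R ?g) \<bullet> ?t \<noteq> 0" using o D by (simp add: inner_simps)
          then show ?thesis unfolding nonsingular_point_def N by auto
        qed
        have orth: "x \<bullet> ?t = 0" if "x \<in> span {partial_s c e s 0, partial_v c e s 0}" for x
        proof -
          have "\<And>y. y \<in> {partial_s c e s 0, partial_v c e s 0} \<Longrightarrow> ?t \<bullet> y = 0"
            using o by (auto simp: ps pv inner_simps inner_commute)
          then have "orthogonal ?t x"
            using orthogonal_to_span[OF that] by (auto simp: orthogonal_def)
          then show ?thesis by (simp add: orthogonal_def inner_commute)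
        qed
        have "ruled_param c e s 1 + partial_s c e s 1 \<in> tangent_plane c e s 1"
          unfolding tangent_plane_def by (auto intro: span_base)
        also have "\<dots> = tangent_plane c e s 0" using L ns by blast
        finally obtain x where x: "c s + ?e + partial_s c e s 1 = c s + x" "x \<bullet> ?t = 0"
          unfolding tangent_plane_def using orth by (auto simp: ruled_param_def)
        then have "x = ?e + partial_s c e s 1" by (simp add: add.assoc)
        then show False using x o by (simp add: ps inner_simps)
      qed
    qed
  qed
  then show ?thesis by (auto simp: developable_def)
qed

lemma offset_dual_g:
  assumes "ruled_surface I c e" "bertrand_offset I c e I1 c1 e1 \<sigma>"
    "offset_dual_angle I c e c1 e1 \<sigma> \<theta> \<theta>'" "s \<in> I"
  shows "dual_g c1 e1 (\<sigma> s) =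
    dual_sin (\<theta> s, \<theta>' s) *\<^sub>D dual_e c e s + dual_cos (\<theta> s, \<theta>' s) *\<^sub>D dual_g c e s"
proof -
  note o = frame_orthonormal[OF assms(1,4)]
  let ?e = "dual_e c e s" and ?t = "dual_t c e s" and ?g = "dual_g c e s"
  have scale: "dual_cross (x *\<^sub>D a - y *\<^sub>D b) d = x *\<^sub>D dual_cross a d - y *\<^sub>D dual_cross b d" for x y a b d
    by (simp add: dual_cross_def dual_scale_def cross3_simps algebra_simps)
  have "dual_cross ?g ?t = (- e s, cross3 (c s) (- e s))"
  proof -
    have "cross3 (gvec e s) (cross3 (c s) (tvec e s)) + cross3 (cross3 (c s) (gvec e s)) (tvec e s)
        = cross3 (c s) (cross3 (gvec e s) (tvec e s))"
      by (simp add: cross3_simps)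
    then show ?thesis using o by (simp add: dual_g_eq dual_t_def dual_cross_def)
  qed
  then have gt: "dual_cross ?g ?t = - ?e" by (simp add: dual_e_def cross_minus_right)
  have "dual_g c1 e1 (\<sigma> s) = dual_cross (dual_e c1 e1 (\<sigma> s)) ?t"
    using assms(2,4) by (simp add: dual_g_def bertrand_offset_def)
  also have "\<dots> = dual_cos (\<theta> s, \<theta>' s) *\<^sub>D ?g - dual_sin (\<theta> s, \<theta>' s) *\<^sub>D (- ?e)"
    using assms(3,4) by (simp add: offset_dual_angle_def scale gt dual_g_def[symmetric])
  finally show ?thesis by (simp add: dual_scale_def)
qed

end

theory Submission
  imports Defs
begin

text \<open>The dual relations between the two Darboux frames carry two pieces of real information. Their
  real parts say that \<open>e\<^sub>1, t\<^sub>1, g\<^sub>1\<close> arise from \<open>e, t, g\<close> by a rotation through \<open>\<theta>\<close> about \<open>t = t\<^sub>1\<close>.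
  Their dual parts say that the striction points differ by a multiple of this common normal,
  \<open>c\<^sub>1 = c + \<theta>\<^sup>* t\<close> (\<open>offset_striction_point\<close>). Comments write \<open>\<theta>\<^sup>*\<close> for the offset distance, which is
  the variable \<open>\<theta>'\<close> of the statements, and reserve the prime for derivatives. Differentiating along \<open>s\<close>, with \<open>\<sigma>'\<close> the speed of the
  parameter change, and taking components along \<open>g\<^sub>1 = sin \<theta> e + cos \<theta> g\<close> yields
  \<^item> from \<open>c\<^sub>1 = c + \<theta>\<^sup>* t\<close>: \<open>\<sigma>' \<Delta>\<^sub>1 = \<delta> sin \<theta> + \<Delta> cos \<theta> - \<theta>\<^sup>* (sin \<theta> - \<gamma> cos \<theta>)\<close> (\<open>offset_Delta\<close>);
  \<^item> from \<open>t\<^sub>1 = t\<close>: \<open>\<sigma>' \<gamma>\<^sub>1 = \<gamma> cos \<theta> - sin \<theta>\<close> (\<open>offset_conical_curvature\<close>).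

  The second formula shows that \<open>\<sigma>' \<noteq> 0\<close> as soon as the denominator \<open>sin \<theta> - \<gamma> cos \<theta>\<close> does not
  vanish. With \<open>\<Delta> = 0\<close> the first formula then says that \<open>\<Delta>\<^sub>1 = 0\<close> exactly when
  \<open>\<theta>\<^sup>* (sin \<theta> - \<gamma> cos \<theta>) = \<delta> sin \<theta>\<close>. Differentiating \<open>c\<^sub>1\<close> and \<open>t\<^sub>1\<close>
  rather than \<open>e\<^sub>1\<close> keeps derivatives of the angle \<open>\<theta>\<close> out of the computation.\<close>

lemma offset_frame:
  assumes "ruled_surface I c e" "bertrand_offset I c e I1 c1 e1 \<sigma>"
    "offset_dual_angle I c e c1 e1 \<sigma> \<theta> \<theta>'" "s \<in> I"
  shows "\<sigma> s \<in> I1"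
    "tvec e1 (\<sigma> s) = tvec e s"
    "gvec e1 (\<sigma> s) = sin (\<theta> s) *\<^sub>R e s + cos (\<theta> s) *\<^sub>R gvec e s"
proof -
  show "\<sigma> s \<in> I1"
    using assms(2,4) by (auto simp: bertrand_offset_def bij_betw_def)
  show "tvec e1 (\<sigma> s) = tvec e s"
    using assms(2,4) by (simp add: bertrand_offset_def dual_t_def)
  show "gvec e1 (\<sigma> s) = sin (\<theta> s) *\<^sub>R e s + cos (\<theta> s) *\<^sub>R gvec e s"
    using arg_cong[OF offset_dual_g[OF assms], of fst]
    by (simp add: dual_g_eq dual_e_def dual_scale_def dual_cos_eq dual_sin_eq)
qed

text \<open>The dual part of \<open>t\<^sub>1 = t\<close> reads \<open>(c\<^sub>1 - c) \<times> t = 0\<close>, so \<open>c\<^sub>1 - c\<close> is a multiple of \<open>t\<close>. The dual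
  part of the relation for \<open>e\<^sub>1\<close> reads \<open>(c\<^sub>1 - c) \<times> e\<^sub>1 = - \<theta>\<^sup>* g\<^sub>1\<close>, which identifies the factor
  because \<open>t \<times> e\<^sub>1 = - g\<^sub>1\<close>.\<close>

lemma offset_striction_point:
  assumes "ruled_surface I c e" "ruled_surface I1 c1 e1" "bertrand_offset I c e I1 c1 e1 \<sigma>"
    "offset_dual_angle I c e c1 e1 \<sigma> \<theta> \<theta>'" "s \<in> I"
  shows "c1 (\<sigma> s) = c s + \<theta>' s *\<^sub>R tvec e s"
proof -
  note fr = offset_frame[OF assms(1,3,4,5)]
  note o = frame_orthonormal[OF assms(1,5)]
  note o1 = frame_orthonormal[OF assms(2) fr(1)]
  let ?w = "c1 (\<sigma> s) - c s"
  have "cross3 (c1 (\<sigma> s)) (tvec e s) = cross3 (c s) (tvec e s)"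
    using assms(3,5) fr(2) by (auto simp: bertrand_offset_def dual_t_def)
  then have "cross3 ?w (tvec e s) = 0"
    by (simp add: Cross3.left_diff_distrib)
  then have w: "?w = (?w \<bullet> tvec e s) *\<^sub>R tvec e s"
    using Lagrange[of "tvec e s" ?w "tvec e s"] o(2) by (simp add: inner_commute)
  have E: "dual_e c1 e1 (\<sigma> s) =
      dual_cos (\<theta> s, \<theta>' s) *\<^sub>D dual_e c e s - dual_sin (\<theta> s, \<theta>' s) *\<^sub>D dual_g c e s"
    using assms(4,5) by (simp add: offset_dual_angle_def)
  have e1: "e1 (\<sigma> s) = cos (\<theta> s) *\<^sub>R e s - sin (\<theta> s) *\<^sub>R gvec e s"
    using arg_cong[OF E, of fst]
    by (simp add: dual_g_eq dual_e_def dual_scale_def dual_cos_eq dual_sin_eq)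
  have "cross3 (c1 (\<sigma> s)) (e1 (\<sigma> s)) = cross3 (c s) (e1 (\<sigma> s)) - \<theta>' s *\<^sub>R gvec e1 (\<sigma> s)"
    using arg_cong[OF E, of snd]
    by (simp add: dual_g_eq dual_e_def dual_scale_def dual_cos_eq dual_sin_eq e1 fr(3)
        Cross3.right_diff_distrib cross_mult_right algebra_simps)
  then have "cross3 ?w (e1 (\<sigma> s)) = - (\<theta>' s *\<^sub>R gvec e1 (\<sigma> s))"
    by (simp add: Cross3.left_diff_distrib)
  moreover have "cross3 ?w (e1 (\<sigma> s)) = - ((?w \<bullet> tvec e s) *\<^sub>R gvec e1 (\<sigma> s))"
    by (subst w) (simp add: cross_mult_left gvec_def fr(2) cross_skew[of "tvec e s"])
  ultimately have "\<theta>' s *\<^sub>R gvec e1 (\<sigma> s) = (?w \<bullet> tvec e s) *\<^sub>R gvec e1 (\<sigma> s)"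
    by (metis neg_equal_iff_equal)
  moreover have "gvec e1 (\<sigma> s) \<noteq> 0"
    using o1(6) by auto
  ultimately have "?w \<bullet> tvec e s = \<theta>' s"
    by (metis scaleR_cancel_right)
  then have "?w = \<theta>' s *\<^sub>R tvec e s"
    using w by metis
  then show ?thesis
    by (metis add.commute diff_add_cancel)
qed

text \<open>The common vector \<open>t\<^sub>1 = t\<close> has two expressions for its derivative, one from each Darboux frame:
  \<open>\<sigma>' (\<gamma>\<^sub>1 g\<^sub>1 - e\<^sub>1) = \<gamma> g - e\<close>. The formula is the \<open>g\<^sub>1\<close>-component of this equation; it serves to show
  that \<open>\<sigma>'\<close> does not vanish.\<close>

lemma offset_conical_curvature:
  assumes "ruled_surface I c e" "ruled_surface I1 c1 e1" "bertrand_offset I c e I1 c1 e1 \<sigma>"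
    "offset_dual_angle I c e c1 e1 \<sigma> \<theta> \<theta>'" "s \<in> I"
  shows "deriv \<sigma> s * conical_curvature e1 (\<sigma> s) =
    conical_curvature e s * cos (\<theta> s) - sin (\<theta> s)"
proof -
  note fr = offset_frame[OF assms(1,3,4)]
  note o = frame_orthonormal[OF assms(1,5)]
  note o1 = frame_orthonormal[OF assms(2) fr(1)[OF assms(5)]]
  have I: "open I"
    using assms(1) by (simp add: ruled_surface_def)
  have "(\<sigma> has_vector_derivative deriv \<sigma> s) (at s)"
    using assms(3,5)
    by (auto simp: bertrand_offset_def has_real_derivative_iff_has_vector_derivative[symmetric]
        DERIV_deriv_iff_real_differentiable)
  from vector_diff_chain_at[OF this darboux_formulas(2)[OF assms(2) fr(1)[OF assms(5)]]]
  have "(tvec e has_vector_derivative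
      deriv \<sigma> s *\<^sub>R (conical_curvature e1 (\<sigma> s) *\<^sub>R gvec e1 (\<sigma> s) - e1 (\<sigma> s))) (at s)"
    by (rule has_vector_derivative_transform_within_open[OF _ I assms(5)]) (simp add: fr(2))
  from vector_derivative_unique_at[OF this darboux_formulas(2)[OF assms(1,5)]]
  have "(deriv \<sigma> s *\<^sub>R (conical_curvature e1 (\<sigma> s) *\<^sub>R gvec e1 (\<sigma> s) - e1 (\<sigma> s))) \<bullet> gvec e1 (\<sigma> s)
      = (conical_curvature e s *\<^sub>R gvec e s - e s) \<bullet> gvec e1 (\<sigma> s)"
    by simp
  also have "\<dots> = conical_curvature e s * cos (\<theta> s) - sin (\<theta> s)"
    using o by (simp add: fr(3)[OF assms(5)] inner_simps inner_commute)
  finally show ?thesis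
    using o1 by (simp add: inner_simps inner_commute)
qed

text \<open>This is the \<open>g\<^sub>1\<close>-component of \<open>\<sigma>' c\<^sub>1' = c' + \<theta>\<^sup>* (\<gamma> g - e) + (\<theta>\<^sup>*)' t\<close>, where \<open>\<Delta>\<close> and \<open>\<delta>\<close> are the
  components of \<open>c'\<close> along \<open>g\<close> and \<open>e\<close>.\<close>

lemma offset_Delta:
  assumes "ruled_surface I c e" "ruled_surface I1 c1 e1" "bertrand_offset I c e I1 c1 e1 \<sigma>"
    "offset_dual_angle I c e c1 e1 \<sigma> \<theta> \<theta>'" "s \<in> I"
  shows "deriv \<sigma> s * Delta c1 e1 (\<sigma> s) =
    delta c e s * sin (\<theta> s) + Delta c e s * cos (\<theta> s)
      - \<theta>' s * (sin (\<theta> s) - conical_curvature e s * cos (\<theta> s))"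
proof -
  note fr = offset_frame[OF assms(1,3,4)]
  note o = frame_orthonormal[OF assms(1,5)]
  note striction = offset_striction_point[OF assms(1-4)]
  have I: "open I"
    using assms(1) by (simp add: ruled_surface_def)
  let ?t' = "conical_curvature e s *\<^sub>R gvec e s - e s"
  have dc: "(c has_vector_derivative vector_derivative c (at s)) (at s)"
    using assms(1,5) by (auto simp: ruled_surface_def vector_derivative_works)
  have dc1: "(c1 has_vector_derivative vector_derivative c1 (at (\<sigma> s))) (at (\<sigma> s))"
    using assms(2) fr(1)[OF assms(5)] by (auto simp: ruled_surface_def vector_derivative_works)
  have dt: "(tvec e has_vector_derivative ?t') (at s)"
    by (rule darboux_formulas(2)[OF assms(1,5)])
  have "(\<sigma> has_vector_derivative deriv \<sigma> s) (at s)"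
    using assms(3,5)
    by (auto simp: bertrand_offset_def has_real_derivative_iff_has_vector_derivative[symmetric]
        DERIV_deriv_iff_real_differentiable)
  from vector_diff_chain_at[OF this dc1]
  have dc1\<sigma>: "((\<lambda>x. c1 (\<sigma> x)) has_vector_derivative
      deriv \<sigma> s *\<^sub>R vector_derivative c1 (at (\<sigma> s))) (at s)"
    by (simp add: o_def)
  \<comment> \<open>The offset distance is differentiable because it is the \<open>t\<close>-component of \<open>c\<^sub>1 - c\<close>. Its
     derivative \<open>l\<close> enters only as a multiple of \<open>t\<close>, which is orthogonal to \<open>g\<^sub>1\<close>.\<close>
  obtain l where "((\<lambda>x. (c1 (\<sigma> x) - c x) \<bullet> tvec e x) has_vector_derivative l) (at s)"
    using bounded_bilinear.has_vector_derivative[OF bounded_bilinear_inner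
        has_vector_derivative_diff[OF dc1\<sigma> dc] dt] by blast
  then have "(\<theta>' has_vector_derivative l) (at s)"
    by (rule has_vector_derivative_transform_within_open[OF _ I assms(5)])
      (simp add: striction frame_orthonormal[OF assms(1)])
  then have "((\<lambda>x. c x + \<theta>' x *\<^sub>R tvec e x) has_vector_derivative
      vector_derivative c (at s) + (\<theta>' s *\<^sub>R ?t' + l *\<^sub>R tvec e s)) (at s)"
    by (intro has_vector_derivative_add dc
        bounded_bilinear.has_vector_derivative[OF bounded_bilinear_scaleR] dt)
  then have "((\<lambda>x. c1 (\<sigma> x)) has_vector_derivative
      vector_derivative c (at s) + (\<theta>' s *\<^sub>R ?t' + l *\<^sub>R tvec e s)) (at s)"
    by (rule has_vector_derivative_transform_within_open[OF _ I assms(5)]) (simp add: striction)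
  from vector_derivative_unique_at[OF dc1\<sigma> this]
  have "(deriv \<sigma> s *\<^sub>R vector_derivative c1 (at (\<sigma> s))) \<bullet> gvec e1 (\<sigma> s)
      = (vector_derivative c (at s) + (\<theta>' s *\<^sub>R ?t' + l *\<^sub>R tvec e s)) \<bullet> gvec e1 (\<sigma> s)"
    by simp
  also have "\<dots> = delta c e s * sin (\<theta> s) + Delta c e s * cos (\<theta> s)
      - \<theta>' s * (sin (\<theta> s) - conical_curvature e s * cos (\<theta> s))"
    using o by (simp add: fr(3)[OF assms(5)] inner_simps inner_commute delta_def Delta_eq algebra_simps)
  finally show ?thesis
    by (simp add: Delta_eq)
qed

theorem corollary4p2:
  fixes I I1 :: "real set" and c e c1 e1 :: "real \<Rightarrow> real^3" and \<sigma> \<theta> \<theta>' :: "real \<Rightarrow> real"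
  assumes "ruled_surface I c e" and "ruled_surface I1 c1 e1"
    and "bertrand_offset I c e I1 c1 e1 \<sigma>"
    and "offset_dual_angle I c e c1 e1 \<sigma> \<theta> \<theta>'"
    and "developable I c e"
    and "\<And>s. s \<in> I \<Longrightarrow> sin (\<theta> s) - conical_curvature e s * cos (\<theta> s) \<noteq> 0"
  shows "developable I1 c1 e1 \<longleftrightarrow>
    (\<forall>s\<in>I. \<theta>' s = delta c e s * sin (\<theta> s) / (sin (\<theta> s) - conical_curvature e s * cos (\<theta> s)))"
proof -
  have "Delta c1 e1 (\<sigma> s) = 0 \<longleftrightarrow>
      \<theta>' s = delta c e s * sin (\<theta> s) / (sin (\<theta> s) - conical_curvature e s * cos (\<theta> s))"
    if s: "s \<in> I" for s
  proof -
    have "deriv \<sigma> s \<noteq> 0"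
      using offset_conical_curvature[OF assms(1-4) s] assms(6)[OF s] by auto
    moreover have "Delta c e s = 0"
      using assms(1,5) s by (simp add: developable_iff_Delta)
    ultimately have "Delta c1 e1 (\<sigma> s) = 0 \<longleftrightarrow>
        \<theta>' s * (sin (\<theta> s) - conical_curvature e s * cos (\<theta> s)) = delta c e s * sin (\<theta> s)"
      using offset_Delta[OF assms(1-4) s] by auto
    then show ?thesis
      using assms(6)[OF s] by (simp add: eq_divide_eq)
  qed
  moreover have "I1 = \<sigma> ` I"
    using assms(3) by (simp add: bertrand_offset_def bij_betw_def)
  ultimately show ?thesis
    using developable_iff_Delta[OF assms(2)] by simp
qed

end
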